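(* Let $c$ be an arbitrary complex constant, and prescribe the data $$\psi_{0,0}=1,\qquad \psi_{0,1}=c,\qquad \psi_{0,\ell}=0\ \text{ for } \ell\ge 2 .$$ With this data, the solution $\psi(u,z)=\sum_{k,\ell=0}^\infty a_{k,\ell}u^kz^\ell$ of $\psi\psi_u+u\psi_u^2+\tfrac12\psi_z^2=0$ is $$\psi(u,z)=1+cz+\sum_{k=1}^\infty\sum_{\ell=0}^\infty(-1)^{\ell+1}c^{\ell+2k}\binom{\ell+2k-2}{\ell}\frac{3^{k-1}(2k-2)!}{2^{k-1}(k+1)!\,(k-1)!}\,u^kz^\ell ,$$ and the solution of $-\psi\psi_u+u\psi_u^2+\tfrac12\psi_z^2=0$ is $$\psi(u,z)=1+cz+\sum_{k=1}^\infty\sum_{\ell=0}^\infty(-1)^{\ell+k-1}c^{\ell+2k}\binom{\ell+2k-2}{\ell}\frac{(2k-2)!}{2^{k}\,k!\,(k-1)!}\,u^kz^\ell .$$ Furthermore, both power series converge absolutely for all $(u,z)$ in a neighbourhood of the origin $(0,0)$.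
   Context: Subscripts $u,z$ denote partial derivatives: $\psi_u=\partial\psi/\partial u$, $\psi_z=\partial\psi/\partial z$. Numerical double subscripts denote values of derivatives at the origin: $\psi_{k,\ell}=\dfrac{\partial^{k+\ell}\psi}{\partial u^k\,\partial z^\ell}(0,0)$, so $a_{k,\ell}=\psi_{k,\ell}/(k!\,\ell!)$. The function $\psi$ is complex-valued. *)

theory Defs
  imports "HOL-Analysis.Analysis"
begin

unbundle no vec_syntax
unbundle fps_syntax

text \<open>
  Both equations have the form \<open>\<sigma> \<psi> \<psi>\<^sub>u + u \<psi>\<^sub>u\<^sup>2 + (1/2) \<psi>\<^sub>z\<^sup>2 = 0\<close> with \<open>\<sigma> = 1\<close> or \<open>\<sigma> = -1\<close>.
  A solution is a power series solution at the origin. It is treated twice: as a formal power series,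
  with no convergence assumption, and as a function near the origin given by a convergent power
  series. The variables \<open>u\<close>, \<open>z\<close> are complex.
\<close>

text \<open>
  The formal series \<open>\<Sum> a\<^sub>k\<^sub>l u\<^sup>k z\<^sup>l\<close> is the element \<open>F\<close> of \<open>complex fps fps\<close> with \<open>F $ k $ l = a\<^sub>k\<^sub>l\<close>:
  \<open>u\<close> is the outer variable (\<open>fps_X\<close>) and \<open>z\<close> the variable of the coefficient ring.
\<close>

definition fps_du :: "complex fps fps \<Rightarrow> complex fps fps" where
  "fps_du F = fps_deriv F"

definition fps_dz :: "complex fps fps \<Rightarrow> complex fps fps" where
  "fps_dz F = Abs_fps (\<lambda>k. fps_deriv (F $ k))"

definition fps_deriv_at_origin :: "complex fps fps \<Rightarrow> nat \<Rightarrow> nat \<Rightarrow> complex" where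
  "fps_deriv_at_origin F k l = ((fps_du ^^ k) ((fps_dz ^^ l) F)) $ 0 $ 0"

definition formal_solution :: "complex \<Rightarrow> complex \<Rightarrow> complex fps fps \<Rightarrow> bool" where
  "formal_solution \<sigma> c F \<longleftrightarrow>
     fps_const (fps_const \<sigma>) * F * fps_du F + fps_X * (fps_du F)\<^sup>2
       + fps_const (fps_const (1/2)) * (fps_dz F)\<^sup>2 = 0 \<and>
     fps_deriv_at_origin F 0 0 = 1 \<and>
     fps_deriv_at_origin F 0 1 = c \<and>
     (\<forall>l\<ge>2. fps_deriv_at_origin F 0 l = 0)"

definition partial_u :: "(complex \<Rightarrow> complex \<Rightarrow> complex) \<Rightarrow> complex \<Rightarrow> complex \<Rightarrow> complex" where
  "partial_u \<psi> u z = deriv (\<lambda>v. \<psi> v z) u"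

definition partial_z :: "(complex \<Rightarrow> complex \<Rightarrow> complex) \<Rightarrow> complex \<Rightarrow> complex \<Rightarrow> complex" where
  "partial_z \<psi> u z = deriv (\<lambda>w. \<psi> u w) z"

definition deriv_at_origin :: "(complex \<Rightarrow> complex \<Rightarrow> complex) \<Rightarrow> nat \<Rightarrow> nat \<Rightarrow> complex" where
  "deriv_at_origin \<psi> k l = ((partial_u ^^ k) ((partial_z ^^ l) \<psi>)) 0 0"

text \<open>
  The first conjunct makes \<open>\<psi>\<close> analytic near the origin, so that \<open>deriv\<close>, which has an unspecified
  value at points of non-differentiability, denotes genuine derivatives there.
\<close>

definition analytic_solution ::
    "complex \<Rightarrow> complex \<Rightarrow> (complex \<Rightarrow> complex \<Rightarrow> complex) \<Rightarrow> bool" where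
  "analytic_solution \<sigma> c \<psi> \<longleftrightarrow>
     (\<exists>a :: nat \<Rightarrow> nat \<Rightarrow> complex. \<forall>\<^sub>F (u, z) in nhds (0, 0).
        ((\<lambda>(k, l). a k l * u ^ k * z ^ l) has_sum \<psi> u z) UNIV) \<and>
     (\<forall>\<^sub>F (u, z) in nhds (0, 0).
        \<sigma> * \<psi> u z * partial_u \<psi> u z + u * (partial_u \<psi> u z)\<^sup>2
          + 1/2 * (partial_z \<psi> u z)\<^sup>2 = 0) \<and>
     deriv_at_origin \<psi> 0 0 = 1 \<and>
     deriv_at_origin \<psi> 0 1 = c \<and>
     (\<forall>l\<ge>2. deriv_at_origin \<psi> 0 l = 0)"

text \<open>
  The coefficients of \<open>u\<^sup>k z\<^sup>l\<close> for \<open>k \<ge> 1\<close> (only used there, so no subtraction truncates), for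
  \<open>\<sigma> = 1\<close> and \<open>\<sigma> = -1\<close> respectively.
\<close>

definition coeff_plus :: "complex \<Rightarrow> nat \<Rightarrow> nat \<Rightarrow> complex" where
  "coeff_plus c k l =
     (-1) ^ (l + 1) * c ^ (l + 2*k) * of_nat ((l + 2*k - 2) choose l) *
     (3 ^ (k - 1) * fact (2*k - 2) / (2 ^ (k - 1) * fact (k + 1) * fact (k - 1)))"

definition coeff_minus :: "complex \<Rightarrow> nat \<Rightarrow> nat \<Rightarrow> complex" where
  "coeff_minus c k l =
     (-1) ^ (l + k - 1) * c ^ (l + 2*k) * of_nat ((l + 2*k - 2) choose l) *
     (fact (2*k - 2) / (2 ^ k * fact k * fact (k - 1)))"

text \<open>All coefficients of \<open>1 + c z + \<Sum>\<^bsub>k \<ge> 1\<^esub> \<Sum>\<^bsub>l \<ge> 0\<^esub> b\<^sub>k\<^sub>l u\<^sup>k z\<^sup>l\<close>.\<close>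

definition full_coeff :: "complex \<Rightarrow> (nat \<Rightarrow> nat \<Rightarrow> complex) \<Rightarrow> nat \<Rightarrow> nat \<Rightarrow> complex" where
  "full_coeff c b k l =
     (if k = 0 then (if l = 0 then 1 else if l = 1 then c else 0) else b k l)"

end

theory Submission
  imports Defs
begin

text \<open>
  Both equations are invariant under a scaling, which reduces them to an ordinary differential
  equation with an algebraic solution. Put \<open>w = 1 + c z\<close>, which is the prescribed value of \<open>\<psi>\<close> at
  \<open>u = 0\<close>, and try \<open>\<psi> = w \<phi>(t)\<close> with \<open>t = c\<^sup>2 u / w\<^sup>2\<close>. Then \<open>\<psi>\<^sub>u = c\<^sup>2 \<phi>' / w\<close> and
  \<open>\<psi>\<^sub>z = c (\<phi> - 2 t \<phi>')\<close>, so \<open>w\<close> cancels, and \<open>\<psi>\<close> solves the equation as soon as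
    \<open>\<sigma> \<phi> \<phi>' + t \<phi>'\<^sup>2 + (1/2) (\<phi> - 2 t \<phi>')\<^sup>2 = 0\<close>, \<open>\<phi>(0) = 1\<close>
  (\<open>similarity_series_solves\<close>). For \<open>\<sigma> = -1\<close> the profile is \<open>\<phi> = (1 + s) / 2\<close> with \<open>s = (1 + 2 t)\<^sup>1\<^sup>/\<^sup>2\<close>;
  for \<open>\<sigma> = 1\<close> it is given by \<open>27 t \<phi> = 1 + 18 t - s\<^sup>3\<close> with \<open>s = (1 - 6 t)\<^sup>1\<^sup>/\<^sup>2\<close>, that is,
  \<open>\<phi> = 2 (2 + s)\<^sup>2 / (9 (1 + s))\<close>. The binomial series of \<open>s\<close> and \<open>s\<^sup>3\<close> produce the factorials of the
  statement, and the expansion of \<open>w\<^sup>1\<^sup>-\<^sup>2\<^sup>k\<close> in powers of \<open>z\<close> produces the factor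
  \<open>(-c)\<^sup>l\<close> times the binomial coefficient.

  The solution is unique because the coefficient of \<open>u\<^sup>n\<close> in the equation contains the highest unknown
  row only in the term \<open>\<sigma> (n + 1) w \<psi>\<^sub>n\<^sub>+\<^sub>1\<close>, whose factor \<open>\<sigma> (n + 1) w\<close> is not zero
  (\<open>formal_solution_unique\<close>).

  The statement about functions follows from the one about formal series. Convergent double series are
  those whose coefficients are bounded by \<open>M / r\<^sup>k\<^sup>+\<^sup>l\<close> for some \<open>M\<close> and \<open>r > 0\<close>, and
  on these the passage from the series to the function is injective and respects sums, products and both derivatives; so a function is an
  analytic solution if and only if it is represented by a formal solution
  (\<open>analytic_solution_iff_formal\<close>). The only formal solution has geometrically bounded
  coefficients, and this is also the absolute convergence that is claimed.
\<close>

section \<open>Substituting a multiple of the outer variable\<close>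

text \<open>
  The series \<open>P(r u)\<close>, where \<open>P\<close> has constant coefficients and \<open>r\<close> is a power series in \<open>z\<close>. The
  substitution is a ring homomorphism, which carries an identity for \<open>P\<close> over to the double series.
\<close>

definition dilation :: "complex fps \<Rightarrow> complex fps \<Rightarrow> complex fps fps" where
  "dilation r P = Abs_fps (\<lambda>k. fps_const (P $ k) * r ^ k)"

lemma dilation_add: "dilation r (P + Q) = dilation r P + dilation r Q"
  by (simp add: dilation_def fps_eq_iff fps_const_add[symmetric] algebra_simps del: fps_const_add)

lemma fps_const_sum: "fps_const (sum f A) = (\<Sum>x\<in>A. fps_const (f x))"
  by (induction A rule: infinite_finite_induct) (simp_all add: fps_const_add[symmetric] del: fps_const_add)

lemma dilation_mult: "dilation r (P * Q) = dilation r P * dilation r Q"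
proof (rule fps_ext)
  fix n :: nat
  have "dilation r (P * Q) $ n = (\<Sum>i=0..n. fps_const (P $ i * Q $ (n - i)) * r ^ n)"
    by (simp add: dilation_def fps_mult_nth fps_const_sum sum_distrib_right)
  also have "\<dots> = (\<Sum>i=0..n. (fps_const (P $ i) * r ^ i) * (fps_const (Q $ (n - i)) * r ^ (n - i)))"
  proof (intro sum.cong refl)
    fix i assume "i \<in> {0..n}"
    hence "r ^ n = r ^ i * r ^ (n - i)" by (simp flip: power_add)
    thus "fps_const (P $ i * Q $ (n - i)) * r ^ n
        = (fps_const (P $ i) * r ^ i) * (fps_const (Q $ (n - i)) * r ^ (n - i))"
      by (simp add: mult_ac flip: fps_const_mult)
  qed
  finally show "dilation r (P * Q) $ n = (dilation r P * dilation r Q) $ n"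
    by (simp add: dilation_def fps_mult_nth)
qed

lemma dilation_const: "dilation r (fps_const s) = fps_const (fps_const s)"
  by (simp add: dilation_def fps_eq_iff)

lemma dilation_X: "dilation r fps_X = fps_const r * fps_X"
  by (simp add: dilation_def fps_eq_iff fps_X_def)

lemma dilation_0: "dilation r 0 = 0"
  by (simp add: dilation_def fps_eq_iff)

lemma du_dilation:
  "fps_du (fps_const w * dilation r P) = fps_const (w * r) * dilation r (fps_deriv P)"
  by (simp add: fps_du_def dilation_def fps_eq_iff mult_ac fps_of_nat[symmetric]
      fps_const_mult[symmetric] del: fps_const_mult)

section \<open>The similarity reduction\<close>

text \<open>
  If \<open>\<psi> = w P(c\<^sup>2 u / w\<^sup>2)\<close> with \<open>w\<^sub>z = c\<close>, then \<open>\<psi>\<^sub>z\<close> is \<open>c\<close> times this series, evaluated at the same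
  argument.
\<close>

definition euler_defect :: "complex fps \<Rightarrow> complex fps" where
  "euler_defect P = P - fps_const 2 * fps_X * fps_deriv P"

lemma euler_defect_nth: "euler_defect P $ k = (1 - 2 * of_nat k) * P $ k"
  by (cases k) (simp_all add: euler_defect_def algebra_simps mult.assoc)

definition similarity_ode :: "complex \<Rightarrow> complex fps \<Rightarrow> bool" where
  "similarity_ode \<sigma> P \<longleftrightarrow>
     fps_const \<sigma> * P * fps_deriv P + fps_X * (fps_deriv P)\<^sup>2
       + fps_const (1/2) * (euler_defect P)\<^sup>2 = 0"

context
  fixes c :: complex
begin

definition "initial_row = 1 + fps_const c * fps_X"

definition similarity_series :: "complex fps \<Rightarrow> complex fps fps" where
  "similarity_series P =
     fps_const initial_row * dilation (fps_const (c\<^sup>2) * (inverse initial_row)\<^sup>2) P"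

lemma initial_row_inverse: "initial_row * inverse initial_row = 1"
  by (simp add: inverse_mult_eq_1' initial_row_def)

lemma deriv_initial_row: "fps_deriv initial_row = fps_const c"
  by (simp add: initial_row_def)

lemma deriv_inverse_initial_row: "fps_deriv (inverse initial_row) = - fps_const c * (inverse initial_row)\<^sup>2"
proof -
  have "fps_deriv (inverse initial_row) = - fps_deriv initial_row * (inverse initial_row)\<^sup>2"
    by (rule fps_inverse_deriv) (simp add: initial_row_def)
  thus ?thesis by (simp add: deriv_initial_row)
qed

lemma deriv_initial_row_power:
  "fps_deriv (initial_row * inverse initial_row ^ (2 * k)) = fps_const (c * (1 - 2 * of_nat k)) * inverse initial_row ^ (2 * k)"
proof (cases k)
  case 0
  then show ?thesis by (simp add: deriv_initial_row)
next
  case (Suc j)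
  have "initial_row * inverse initial_row ^ (2 * k) = inverse initial_row ^ Suc (2 * j)"
    using initial_row_inverse Suc by (simp add: algebra_simps)
  hence "fps_deriv (initial_row * inverse initial_row ^ (2 * k)) =
     fps_const (of_nat (Suc (2*j))) * fps_deriv (inverse initial_row) * inverse initial_row ^ (2 * j)"
    by (simp only: fps_deriv_power) simp
  also have "\<dots> = fps_const (c * (1 - 2 * of_nat k)) * inverse initial_row ^ (2 * k)"
  proof -
    have "fps_const (of_nat (Suc (2*j))) * (- fps_const c * (inverse initial_row)\<^sup>2) * inverse initial_row ^ (2 * j)
       = - (fps_const (of_nat (Suc (2*j))) * fps_const c) * inverse initial_row ^ (2 * j + 2)"
      by (simp only: power_add mult_ac mult_minus_left mult_minus_right)
    also have "- (fps_const (of_nat (Suc (2*j))) * fps_const c) = fps_const (c * (1 - 2 * of_nat k))"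
      by (simp add: Suc algebra_simps)
    finally show ?thesis by (simp add: deriv_inverse_initial_row Suc)
  qed
  finally show ?thesis .
qed

text \<open>
  Row by row: the coefficient of \<open>u\<^sup>k\<close> in the similarity series is a constant times
  \<open>w\<^sup>1\<^sup>-\<^sup>2\<^sup>k\<close>, and differentiating this power yields the factor \<open>1 - 2 k\<close>, which is
  also the factor between the \<open>k\<close>-th coefficients of \<open>P\<close> and of \<open>P - 2 t P'\<close>.
\<close>

lemma dz_similarity_series:
  "fps_dz (similarity_series P) =
     fps_const (fps_const c) * dilation (fps_const (c\<^sup>2) * (inverse initial_row)\<^sup>2) (euler_defect P)"
proof (rule fps_ext)
  fix k :: nat
  have "similarity_series P $ k = fps_const (P $ k * c ^ (2 * k)) * (initial_row * inverse initial_row ^ (2 * k))"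
    by (simp add: similarity_series_def dilation_def power_mult_distrib fps_const_power mult_ac
        flip: power_mult fps_const_mult)
  hence "fps_deriv (similarity_series P $ k) =
     fps_const (P $ k * c ^ (2 * k)) * (fps_const (c * (1 - 2 * of_nat k)) * inverse initial_row ^ (2 * k))"
    by (simp only: fps_deriv_mult_const_left deriv_initial_row_power)
  also have "\<dots> = fps_const c * (fps_const ((1 - 2 * of_nat k) * P $ k) * (fps_const (c\<^sup>2) * (inverse initial_row)\<^sup>2) ^ k)"
    by (simp add: power_mult_distrib fps_const_power mult_ac flip: power_mult fps_const_mult)
  finally show "fps_dz (similarity_series P) $ k =
    (fps_const (fps_const c) * dilation (fps_const (c\<^sup>2) * (inverse initial_row)\<^sup>2) (euler_defect P)) $ k"
    by (simp add: fps_dz_def dilation_def euler_defect_nth)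
qed

text \<open>
  All three terms of the equation carry the same power of \<open>w\<close>: with \<open>r = c\<^sup>2 / w\<^sup>2\<close>, the prefactors are
  \<open>w (w r) = c\<^sup>2\<close>, \<open>(w r)\<^sup>2 = c\<^sup>2 r\<close> and \<open>c\<^sup>2\<close>, where the extra \<open>r\<close> turns \<open>u\<close> into the similarity variable
  \<open>r u\<close>. Hence the left-hand side is \<open>c\<^sup>2\<close> times the dilation of the ordinary differential equation.
\<close>

lemma similarity_series_solves:
  assumes "similarity_ode \<sigma> P"
  shows "fps_const (fps_const \<sigma>) * similarity_series P * fps_du (similarity_series P)
      + fps_X * (fps_du (similarity_series P))\<^sup>2
      + fps_const (fps_const (1/2)) * (fps_dz (similarity_series P))\<^sup>2 = 0"
proof -
  define r where "r = fps_const (c\<^sup>2) * (inverse initial_row)\<^sup>2"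
  have r: "initial_row * r * initial_row = fps_const (c\<^sup>2)"
  proof -
    have "initial_row * r * initial_row = fps_const (c\<^sup>2) * (initial_row * inverse initial_row)\<^sup>2"
      by (simp add: r_def power2_eq_square algebra_simps)
    thus ?thesis by (simp add: initial_row_inverse)
  qed
  have r2: "(initial_row * r)\<^sup>2 = fps_const (c\<^sup>2) * r"
    using r by (simp add: power2_eq_square mult_ac)
  have eq: "dilation r (fps_const \<sigma> * P * fps_deriv P + fps_X * (fps_deriv P)\<^sup>2
       + fps_const (1/2) * (euler_defect P)\<^sup>2) = 0"
    using assms by (simp add: similarity_ode_def dilation_0)
  have r': "fps_const initial_row * fps_const r * fps_const initial_row = fps_const (fps_const (c\<^sup>2))"
    using r by simp
  have r2': "(fps_const (initial_row * r))\<^sup>2 = fps_const (fps_const (c\<^sup>2)) * fps_const r"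
    using r2 by (simp add: fps_const_power)
  have s: "similarity_series P = fps_const initial_row * dilation r P"
    by (simp add: similarity_series_def r_def)
  have du: "fps_du (similarity_series P) = fps_const (initial_row * r) * dilation r (fps_deriv P)"
    unfolding s by (rule du_dilation)
  have dz: "fps_dz (similarity_series P) = fps_const (fps_const c) * dilation r (euler_defect P)"
    unfolding dz_similarity_series r_def ..
  have "fps_const (fps_const \<sigma>) * similarity_series P * fps_du (similarity_series P)
      + fps_X * (fps_du (similarity_series P))\<^sup>2
      + fps_const (fps_const (1/2)) * (fps_dz (similarity_series P))\<^sup>2
    = (fps_const initial_row * fps_const r * fps_const initial_row) * (fps_const (fps_const \<sigma>) * dilation r P * dilation r (fps_deriv P))
     + fps_X * ((fps_const (initial_row * r))\<^sup>2 * (dilation r (fps_deriv P))\<^sup>2)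
     + fps_const (fps_const (1/2)) * ((fps_const (fps_const c))\<^sup>2 * (dilation r (euler_defect P))\<^sup>2)"
    unfolding du dz unfolding s by (simp add: power_mult_distrib mult_ac flip: fps_const_mult)
  also have "\<dots> = fps_const (fps_const (c\<^sup>2)) * dilation r (fps_const \<sigma> * P * fps_deriv P + fps_X * (fps_deriv P)\<^sup>2
       + fps_const (1/2) * (euler_defect P)\<^sup>2)"
    unfolding r' r2' unfolding dilation_add dilation_mult dilation_const dilation_X power2_eq_square
    by (simp add: algebra_simps flip: fps_const_mult)
  finally show ?thesis using eq by simp
qed

end

section \<open>Uniqueness of the formal solution\<close>

lemma fps_dz_funpow: "((fps_dz ^^ l) F) $ k = (fps_deriv ^^ l) (F $ k)"
  by (induction l) (simp_all add: fps_dz_def)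

lemma fps_deriv_at_origin_0: "fps_deriv_at_origin F 0 l = fact l * F $ 0 $ l"
  by (simp add: fps_deriv_at_origin_def fps_dz_funpow fps_0th_higher_deriv)

lemma initial_row_nth: "initial_row c $ l = (if l = 0 then 1 else if l = 1 then c else 0)"
  unfolding initial_row_def fps_add_nth fps_mult_left_const_nth fps_X_nth fps_one_nth by simp

lemma initial_data_iff:
  "(fps_deriv_at_origin F 0 0 = 1 \<and> fps_deriv_at_origin F 0 1 = c \<and>
     (\<forall>l\<ge>2. fps_deriv_at_origin F 0 l = 0)) \<longleftrightarrow> F $ 0 = initial_row c"
proof
  assume F: "F $ 0 = initial_row c"
  have nth: "F $ 0 $ l = (if l = 0 then 1 else if l = 1 then c else 0)" for l
    unfolding F by (rule initial_row_nth)
  show "fps_deriv_at_origin F 0 0 = 1 \<and> fps_deriv_at_origin F 0 1 = c \<and>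
     (\<forall>l\<ge>2. fps_deriv_at_origin F 0 l = 0)"
    unfolding fps_deriv_at_origin_0 nth by simp
next
  assume data: "fps_deriv_at_origin F 0 0 = 1 \<and> fps_deriv_at_origin F 0 1 = c \<and>
     (\<forall>l\<ge>2. fps_deriv_at_origin F 0 l = 0)"
  show "F $ 0 = initial_row c"
  proof (rule fps_ext)
    fix l :: nat
    consider "l = 0" | "l = 1" | "l \<ge> 2" by linarith
    thus "F $ 0 $ l = initial_row c $ l"
      using data unfolding fps_deriv_at_origin_0 initial_row_nth by cases simp_all
  qed
qed

lemma formal_solution_iff:
  "formal_solution \<sigma> c F \<longleftrightarrow>
     fps_const (fps_const \<sigma>) * F * fps_du F + fps_X * (fps_du F)\<^sup>2
       + fps_const (fps_const (1/2)) * (fps_dz F)\<^sup>2 = 0 \<and> F $ 0 = initial_row c"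
  unfolding formal_solution_def initial_data_iff[where F = F and c = c] by (rule refl)

text \<open>
  Recursion on the power of \<open>u\<close>. In the coefficient of \<open>u\<^sup>m\<close>, the row \<open>m + 1\<close> of the unknown series
  enters only through the product of row \<open>0\<close> with the \<open>u\<close>-derivative: in the term \<open>u \<psi>\<^sub>u\<^sup>2\<close> the factor
  \<open>u\<close> lowers the index by one, and \<open>\<psi>\<^sub>z\<close> does not raise it.
\<close>

lemma formal_solution_unique:
  assumes F: "formal_solution \<sigma> c F" and G: "formal_solution \<sigma> c G" and "\<sigma> \<noteq> 0"
  shows "F = G"
proof (rule fps_ext)
  fix n :: nat
  show "F $ n = G $ n"
  proof (induction n rule: less_induct)
    case (less n)
    show ?case
    proof (cases n)
      case 0
      then show ?thesis using F G by (simp add: formal_solution_iff)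
    next
      case (Suc m)
      (* The coefficient of u^m splits into the part with row m + 1 and the
         remainder, Q and R, that depends on the rows up to m only. *)
      define R where "R H = (fps_X * (fps_du H)\<^sup>2 + fps_const (fps_const (1/2)) * (fps_dz H)\<^sup>2) $ m" for H
      define Q where "Q H = (\<Sum>i\<in>{1..m}. H $ i * fps_du H $ (m - i))" for H
      have coeff: "fps_const \<sigma> * (initial_row c * (of_nat n * H $ n)) + (fps_const \<sigma> * Q H + R H) = 0"
        if "formal_solution \<sigma> c H" for H
      proof -
        have "0 = (fps_const (fps_const \<sigma>) * (H * fps_du H) + (fps_X * (fps_du H)\<^sup>2
          + fps_const (fps_const (1/2)) * (fps_dz H)\<^sup>2)) $ m"
          using that by (simp add: formal_solution_iff add.assoc mult.assoc)
        also have "\<dots> = fps_const \<sigma> * (\<Sum>i=0..m. H $ i * fps_du H $ (m - i)) + R H"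
          unfolding R_def fps_add_nth fps_mult_left_const_nth by (simp add: fps_mult_nth)
        also have "(\<Sum>i=0..m. H $ i * fps_du H $ (m - i)) = initial_row c * (of_nat n * H $ n) + Q H"
          using that Suc by (simp add: formal_solution_iff Q_def sum.atLeast_Suc_atMost fps_du_def)
        finally show ?thesis by (simp add: algebra_simps)
      qed
      have eq: "F $ i = G $ i" if "i \<le> m" for i
        using less that Suc by simp
      have "Q F = Q G"
        unfolding Q_def fps_du_def by (intro sum.cong refl) (simp add: eq Suc_le_eq)
      moreover have "R F = R G"
      proof -
        have "(fps_X * (fps_du F)\<^sup>2) $ m = (fps_X * (fps_du G)\<^sup>2) $ m"
        proof (cases m)
          case (Suc j)
          have "(\<Sum>i=0..j. fps_du F $ i * fps_du F $ (j - i)) = (\<Sum>i=0..j. fps_du G $ i * fps_du G $ (j - i))"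
            unfolding fps_du_def by (intro sum.cong refl) (simp add: eq Suc)
          hence "(fps_du F * fps_du F) $ j = (fps_du G * fps_du G) $ j"
            by (simp only: fps_mult_nth)
          thus ?thesis using Suc by (simp add: power2_eq_square)
        qed simp
        moreover have "((fps_dz F)\<^sup>2) $ m = ((fps_dz G)\<^sup>2) $ m"
          unfolding power2_eq_square fps_mult_nth fps_dz_def
          by (intro sum.cong refl) (simp add: eq)
        ultimately show ?thesis by (simp add: R_def)
      qed
      ultimately have "fps_const \<sigma> * (initial_row c * (of_nat n * F $ n)) + (fps_const \<sigma> * Q F + R F)
        = fps_const \<sigma> * (initial_row c * (of_nat n * G $ n)) + (fps_const \<sigma> * Q F + R F)"
        using coeff[OF F] coeff[OF G] by (simp only:)
      hence "fps_const \<sigma> * (initial_row c * (of_nat n * F $ n)) = fps_const \<sigma> * (initial_row c * (of_nat n * G $ n))"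
        by (rule add_right_imp_eq)
      hence "(fps_const \<sigma> * (initial_row c * of_nat n)) * F $ n = (fps_const \<sigma> * (initial_row c * of_nat n)) * G $ n"
        by (simp only: mult.assoc)
      moreover have "fps_const \<sigma> * (initial_row c * of_nat n) \<noteq> 0"
      proof -
        (* The constant term in z suffices, since w has constant term 1. *)
        have "(fps_const \<sigma> * (initial_row c * of_nat n)) $ 0 = \<sigma> * of_nat (Suc m)"
          by (simp only: fps_of_nat [symmetric] fps_mult_left_const_nth fps_mult_right_const_nth initial_row_nth Suc) simp
        also have "\<dots> \<noteq> 0" using \<open>\<sigma> \<noteq> 0\<close> by (simp del: of_nat_Suc)
        finally show ?thesis by (metis fps_zero_nth)
      qed
      ultimately show ?thesis using mult_left_cancel by blast
    qed
  qed
qed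

section \<open>The two algebraic profiles\<close>

text \<open>
  The binomial series of \<open>(1 + a t)\<^sup>e\<close>.
\<close>

definition fps_root :: "complex \<Rightarrow> complex \<Rightarrow> complex fps" where
  "fps_root a e = fps_compose (fps_binomial e) (fps_const a * fps_X)"

lemma fps_root_nth: "fps_root a e $ k = a ^ k * (e gchoose k)"
  by (simp add: fps_root_def fps_compose_linear)

lemma fps_root_add: "fps_root a (d + e) = fps_root a d * fps_root a e"
  unfolding fps_root_def fps_binomial_add_mult by (rule fps_compose_mult_distrib) simp

lemma fps_root_1: "fps_root a 1 = 1 + fps_const a * fps_X"
  by (simp add: fps_root_def fps_binomial_1 fps_compose_add_distrib)

lemma fps_root_half_square: "fps_root a (1/2) * fps_root a (1/2) = 1 + fps_const a * fps_X"
  using fps_root_add[of a "1/2" "1/2"] by (simp add: fps_root_1)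

lemma fps_root_half_deriv: "2 * (fps_root a (1/2) * fps_deriv (fps_root a (1/2))) = fps_const a"
  using arg_cong[OF fps_root_half_square[of a], of fps_deriv] by (simp add: algebra_simps)

lemma fps_root_half_nonzero: "fps_root a (1/2) \<noteq> 0"
proof
  assume "fps_root a (1/2) = 0"
  hence "fps_root a (1/2) $ 0 = 0 $ 0" by simp
  thus False by (simp add: fps_root_nth)
qed

lemma gbinomial_Suc_ratio:
  "(e gchoose Suc k) = (e - of_nat k) / of_nat (Suc k) * (e gchoose k)" for e :: complex
  using gbinomial_mult_1[of e k] by (simp add: field_simps del: of_nat_Suc)

definition profile_minus :: "complex fps" where
  "profile_minus = Abs_fps (\<lambda>k. if k = 0 then 1 else
     (-1) ^ (k - 1) * (fact (2*k - 2) / (2 ^ k * fact k * fact (k - 1))))"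

definition profile_plus :: "complex fps" where
  "profile_plus = Abs_fps (\<lambda>k. if k = 0 then 1 else
     - (3 ^ (k - 1) * fact (2*k - 2) / (2 ^ (k - 1) * fact (k + 1) * fact (k - 1))))"

text \<open>
  The factorials are those of the binomial series of \<open>(1 + 2 t)\<^sup>1\<^sup>/\<^sup>2\<close>; both sides satisfy the same first
  order recursion in the index.
\<close>

lemma profile_minus_closed_form: "2 * profile_minus = 1 + fps_root 2 (1/2)"
proof (rule fps_ext)
  fix n :: nat
  have "2 ^ Suc k * ((1/2 :: complex) gchoose Suc k) =
     2 * ((-1) ^ k * (fact (2*k) / (2 ^ Suc k * fact (Suc k) * fact k)))" for k
  proof (induction k)
    case (Suc k)
    have f: "fact (2 * Suc k) = (2 * of_nat k + 2) * (2 * of_nat k + 1) * (fact (2*k) :: complex)"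
      by (simp add: algebra_simps)
    have "2 ^ Suc (Suc k) * ((1/2 :: complex) gchoose Suc (Suc k))
       = 2 * ((1/2 - of_nat (Suc k)) / of_nat (Suc (Suc k))) * (2 ^ Suc k * ((1/2 :: complex) gchoose Suc k))"
      by (subst gbinomial_Suc_ratio) simp
    also have "\<dots> = 2 * ((-1) ^ Suc k * (fact (2*Suc k) / (2 ^ Suc (Suc k) * fact (Suc (Suc k)) * fact (Suc k))))"
    proof -
      have nz: "(of_nat k + 1 :: complex) \<noteq> 0" "(of_nat k + 2 :: complex) \<noteq> 0"
        by (metis of_nat_Suc of_nat_eq_0_iff add.commute nat.distinct(1),
            metis of_nat_eq_0_iff of_nat_add of_nat_numeral add_is_0 zero_neq_numeral)
      have e: "fact (Suc k) = (of_nat k + 1) * (fact k :: complex)"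
         "fact (Suc (Suc k)) = (of_nat k + 2) * (of_nat k + 1) * (fact k :: complex)"
         "of_nat (Suc (Suc k)) = (of_nat k + 2 :: complex)" "of_nat (Suc k) = (of_nat k + 1 :: complex)"
        by (simp_all add: algebra_simps)
      have nz': "(fact k :: complex) \<noteq> 0" "(2 :: complex) ^ k \<noteq> 0" by simp_all
      have *: "2 * ((1/2 - (x + 1)) / (x + 2)) * (2 * (u * (A / (2 * t * ((x + 1) * B) * B))))
          = 2 * (-1 * u * ((2 * x + 2) * (2 * x + 1) * A / (2 * (2 * t) * ((x + 2) * (x + 1) * B) * ((x + 1) * B))))"
        if "x + 1 \<noteq> 0" "x + 2 \<noteq> 0" "B \<noteq> 0" "t \<noteq> 0" for x u A t B :: complex
        using that by (simp add: divide_simps) algebra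
      show ?thesis unfolding Suc unfolding f e power_Suc by (rule *[OF nz nz'])
    qed
    finally show ?case .
  qed simp
  thus "(2 * profile_minus) $ n = (1 + fps_root 2 (1/2)) $ n"
    by (cases n) (simp_all add: profile_minus_def fps_root_nth numeral_fps_const)
qed

text \<open>
  The factor \<open>(k + 1)!\<close> in the denominator indicates an index shift by one, hence the multiplication by
  \<open>t\<close>. The exponent \<open>3/2\<close> accounts for \<open>(2 k - 2)! / ((k + 1)! (k - 1)!)\<close>, and the polynomial
  \<open>1 + 18 t\<close> adjusts the two lowest coefficients. The constant \<open>27\<close> matches the coefficient \<open>27/2\<close> of \<open>t\<^sup>2\<close>
  in \<open>(1 - 6 t)\<^sup>3\<^sup>/\<^sup>2\<close> with the coefficient \<open>-1/2\<close> of \<open>t\<close> in the profile.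
\<close>

lemma profile_plus_closed_form:
  "27 * fps_X * profile_plus = 1 + 18 * fps_X - fps_root (-6) (3/2)"
proof (rule fps_ext)
  fix n :: nat
  have coeff: "(-6) ^ (k + 2) * ((3/2 :: complex) gchoose (k + 2)) =
     27 * (3 ^ k * fact (2*k) / (2 ^ k * fact (k + 2) * fact k))" for k
  proof (induction k)
    case 0
    show ?case by (simp add: gbinomial_Suc_ratio numeral_2_eq_2)
  next
    case (Suc k)
    have f: "fact (2 * Suc k) = (2 * of_nat k + 2) * (2 * of_nat k + 1) * (fact (2*k) :: complex)"
      by (simp add: algebra_simps)
    have "(-6) ^ (Suc k + 2) * ((3/2 :: complex) gchoose (Suc k + 2))
       = -6 * ((3/2 - of_nat (k + 2)) / of_nat (Suc (k + 2))) * ((-6) ^ (k + 2) * ((3/2 :: complex) gchoose (k + 2)))"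
      unfolding add_Suc by (subst gbinomial_Suc_ratio) (simp only: power_Suc mult_ac)
    also have "\<dots> = 27 * (3 ^ Suc k * fact (2 * Suc k) / (2 ^ Suc k * fact (Suc k + 2) * fact (Suc k)))"
    proof -
      have nz: "(of_nat k + 1 :: complex) \<noteq> 0" "(of_nat k + 3 :: complex) \<noteq> 0"
        by (metis of_nat_Suc of_nat_eq_0_iff add.commute nat.distinct(1),
            metis of_nat_eq_0_iff of_nat_add of_nat_numeral add_is_0 zero_neq_numeral)
      have e: "fact (Suc k) = (of_nat k + 1) * (fact k :: complex)"
         "fact (Suc k + 2) = (of_nat k + 3) * (fact (k + 2) :: complex)"
         "of_nat (k + 2) = (of_nat k + 2 :: complex)" "of_nat (Suc (k + 2)) = (of_nat k + 3 :: complex)"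
        by (simp_all add: algebra_simps)
      have nz': "(fact k :: complex) \<noteq> 0" "(2 :: complex) ^ k \<noteq> 0" "(fact (k + 2) :: complex) \<noteq> 0"
        by (simp_all del: add_2_eq_Suc')
      have *: "-6 * ((3/2 - (x + 2)) / (x + 3)) * (27 * (p * A / (t * D * B)))
          = 27 * (3 * p * ((2 * x + 2) * (2 * x + 1) * A) / (2 * t * ((x + 3) * D) * ((x + 1) * B)))"
        if "x + 1 \<noteq> 0" "x + 3 \<noteq> 0" "B \<noteq> 0" "t \<noteq> 0" "D \<noteq> 0" for x p A t B D :: complex
        using that by (simp add: divide_simps) algebra
      show ?thesis unfolding Suc unfolding f e power_Suc by (rule *[OF nz nz'])
    qed
    finally show ?case .
  qed
  consider "n = 0" | "n = 1" | k where "n = k + 2"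
    using that by (cases n; cases "n - 1") auto
  thus "(27 * fps_X * profile_plus) $ n = (1 + 18 * fps_X - fps_root (-6) (3/2)) $ n"
  proof cases
    case 1
    then show ?thesis by (simp add: fps_root_nth numeral_fps_const mult.assoc)
  next
    case 2
    then show ?thesis by (simp add: fps_root_nth numeral_fps_const mult.assoc profile_plus_def)
  next
    case (3 k)
    have "(1 + 18 * fps_X - fps_root (-6) (3/2)) $ n = - ((-6) ^ (k + 2) * ((3/2 :: complex) gchoose (k + 2)))"
      by (simp add: 3 fps_root_nth numeral_fps_const)
    also have "\<dots> = (27 * fps_X * profile_plus) $ n"
      unfolding coeff by (simp add: 3 numeral_fps_const mult.assoc profile_plus_def)
    finally show ?thesis ..
  qed
qed

text \<open>
  With \<open>s\<^sup>2 = 1 + 2 t\<close> and \<open>s s' = 1\<close>, the equation becomes polynomial in \<open>s\<close> and \<open>t\<close> after multiplication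
  by \<open>8 s\<^sup>2\<close>. It then vanishes modulo the relation \<open>s\<^sup>2 = 1 + 2 t\<close>.
\<close>

lemma similarity_ode_profile_minus: "similarity_ode (-1) profile_minus"
proof -
  define S P P' h where "S = fps_root 2 (1/2)" and "P = profile_minus" and "P' = fps_deriv profile_minus"
    and "h = (fps_const (1/2) :: complex fps)"
  have S: "S * S = 1 + 2 * fps_X"
    using fps_root_half_square[of 2] by (simp add: S_def numeral_fps_const)
  have P: "2 * P = 1 + S" using profile_minus_closed_form by (simp add: P_def S_def)
  have "2 * P' = fps_deriv S"
    using arg_cong[OF P, of fps_deriv] by (simp add: P_def P'_def)
  moreover have "2 * (S * fps_deriv S) = 2"
    using fps_root_half_deriv[of 2] by (simp add: S_def numeral_fps_const)
  ultimately have P': "2 * P' * S = 1" by (simp add: mult_ac)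
  have h: "2 * h = 1" by (simp add: h_def numeral_fps_const)
  have "8 * S\<^sup>2 * (- P * P' + fps_X * P'\<^sup>2 + h * (P - 2 * fps_X * P')\<^sup>2)
      = -2 * (2 * P) * (2 * P' * S) * S + 2 * fps_X * (2 * P' * S)\<^sup>2 + (2 * h) * ((2 * P) * S - 2 * fps_X * (2 * P' * S))\<^sup>2"
    by algebra
  also have "\<dots> = -2 * (1 + S) * S + 2 * fps_X + ((1 + S) * S - 2 * fps_X)\<^sup>2"
    unfolding P P' h by simp
  also have "\<dots> = 0" using S by algebra
  finally have "- P * P' + fps_X * P'\<^sup>2 + h * (P - 2 * fps_X * P')\<^sup>2 = 0"
    using fps_root_half_nonzero[of 2] by (simp add: S_def)
  thus ?thesis
    by (simp add: similarity_ode_def euler_defect_def P_def P'_def h_def numeral_fps_const flip: fps_const_neg)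
qed

text \<open>
  As in the previous case, now with \<open>s\<^sup>2 = 1 - 6 t\<close>. The profile is only known after multiplication by
  \<open>27 t\<close> and its derivative after multiplication by \<open>27 t\<^sup>2\<close>, so the equation is multiplied by
  \<open>2 (27)\<^sup>2 t\<^sup>3\<close>.
\<close>

lemma similarity_ode_profile_plus: "similarity_ode 1 profile_plus"
proof -
  define S P P' h where "S = fps_root (-6) (1/2)" and "P = profile_plus" and "P' = fps_deriv profile_plus"
    and "h = (fps_const (1/2) :: complex fps)"
  have S: "S * S = 1 - 6 * fps_X"
    using fps_root_half_square[of "-6"] by (simp add: S_def numeral_fps_const flip: fps_const_neg)
  have "2 * (S * fps_deriv S) = - 6"
    using fps_root_half_deriv[of "-6"] by (simp add: S_def numeral_fps_const)
  hence S': "S * fps_deriv S = - 3" by algebra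
  have S3: "fps_root (-6) (3/2) = S * (1 - 6 * fps_X)"
    using fps_root_add[of "-6" "1/2" 1] by (simp add: S_def fps_root_1 numeral_fps_const flip: fps_const_neg)
  have P: "27 * fps_X * P = 1 + 18 * fps_X - S * (1 - 6 * fps_X)"
    using profile_plus_closed_form by (simp add: P_def S3)
  have "27 * (P + fps_X * P') = 18 - (fps_deriv S * (1 - 6 * fps_X) - 6 * S)"
    using arg_cong[OF P, of fps_deriv] by (simp add: P_def P'_def numeral_fps_const algebra_simps)
  also have "\<dots> = 18 + 9 * S"
    unfolding S[symmetric] using S' by algebra
  finally have P': "27 * fps_X * fps_X * P' = fps_X * (18 + 9 * S) - (1 + 18 * fps_X - S * (1 - 6 * fps_X))"
    using P by algebra
  have h: "2 * h = 1" by (simp add: h_def numeral_fps_const)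
  have "2 * 27\<^sup>2 * fps_X ^ 3 * (P * P' + fps_X * P'\<^sup>2 + h * (P - 2 * fps_X * P')\<^sup>2)
      = 2 * (27 * fps_X * P) * (27 * fps_X * fps_X * P') + 2 * (27 * fps_X * fps_X * P')\<^sup>2
        + (2 * h) * (fps_X * ((27 * fps_X * P) - 2 * (27 * fps_X * fps_X * P'))\<^sup>2)"
    by algebra
  also have "\<dots> = 0" unfolding P P' h mult_1 using S by algebra
  finally have "P * P' + fps_X * P'\<^sup>2 + h * (P - 2 * fps_X * P')\<^sup>2 = 0"
    by simp
  thus ?thesis
    by (simp add: similarity_ode_def euler_defect_def P_def P'_def h_def numeral_fps_const)
qed

section \<open>Coefficients of the similarity series\<close>

text \<open>
  Row \<open>k \<ge> 1\<close> is a multiple of \<open>w\<^sup>1\<^sup>-\<^sup>2\<^sup>k\<close>, the power of a geometric series in \<open>-c z\<close>, whose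
  coefficients are binomial.
\<close>

lemma similarity_series_nth:
  "similarity_series c P $ k $ l = (if k = 0 then P $ 0 * initial_row c $ l else
     (-1) ^ l * c ^ (l + 2*k) * of_nat ((l + 2*k - 2) choose l) * P $ k)"
proof (cases k)
  case 0
  then show ?thesis by (simp add: similarity_series_def dilation_def)
next
  case (Suc j)
  have "similarity_series c P $ k =
     fps_const (P $ k * c ^ (2 * k)) * (initial_row c * inverse (initial_row c) * inverse (initial_row c) ^ Suc (2 * j))"
    by (simp add: similarity_series_def dilation_def power_mult_distrib fps_const_power Suc mult_ac
        flip: power_mult fps_const_mult)
  also have "\<dots> = fps_const (P $ k * c ^ (2 * k)) * inverse (initial_row c ^ Suc (2 * j))"
    by (simp only: initial_row_inverse fps_inverse_power mult_1)
  also have "initial_row c = 1 - fps_const (-c) * fps_X"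
    by (simp add: initial_row_def flip: fps_const_neg)
  also have "inverse (\<dots> ^ Suc (2 * j)) = Abs_fps (\<lambda>l. of_nat ((Suc (2 * j) + l - 1) choose l) * (-c) ^ l)"
    by (rule one_minus_const_fps_X_neg_power') simp
  finally show ?thesis
    by (simp add: Suc power_add power_minus[of c] mult_ac add_ac)
qed

lemma similarity_series_formal_solution:
  assumes "similarity_ode \<sigma> P" "P $ 0 = 1"
  shows "formal_solution \<sigma> c (similarity_series c P)"
  unfolding formal_solution_iff using similarity_series_solves[OF assms(1), of c] assms(2)
  by (auto simp: fps_eq_iff similarity_series_nth)

lemma full_coeff_plus: "full_coeff c (coeff_plus c) k l = similarity_series c profile_plus $ k $ l"
  by (auto simp: full_coeff_def similarity_series_nth coeff_plus_def initial_row_nth profile_plus_def)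

lemma full_coeff_minus: "full_coeff c (coeff_minus c) k l = similarity_series c profile_minus $ k $ l"
  by (cases k) (auto simp: full_coeff_def similarity_series_nth coeff_minus_def initial_row_nth profile_minus_def power_add)

section \<open>Evaluation of convergent double series\<close>

text \<open>
  A double series is evaluated in two stages, first each row in \<open>z\<close> and then the resulting series in
  \<open>u\<close>, so that the theory of power series in one variable applies at each stage.
\<close>

definition row_sums :: "complex fps fps \<Rightarrow> complex \<Rightarrow> complex fps" where
  "row_sums F z = Abs_fps (\<lambda>k. eval_fps (F $ k) z)"

definition eval2 :: "complex fps fps \<Rightarrow> complex \<Rightarrow> complex \<Rightarrow> complex" where
  "eval2 F u z = eval_fps (row_sums F z) u"

definition geometric_bound :: "real \<Rightarrow> complex fps fps \<Rightarrow> bool" where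
  "geometric_bound r F \<longleftrightarrow> (\<exists>M. \<forall>k l. norm (F $ k $ l) * r ^ (k + l) \<le> M)"

lemma geometric_boundD:
  assumes "geometric_bound r F" "r > 0"
  obtains M where "M \<ge> 0" "\<And>k l. norm (F $ k $ l) \<le> M / r ^ (k + l)"
proof -
  obtain M where M: "\<And>k l. norm (F $ k $ l) * r ^ (k + l) \<le> M"
    using assms(1) unfolding geometric_bound_def by blast
  show ?thesis
  proof
    show "M \<ge> 0" using order_trans[OF norm_ge_zero, of "F $ 0 $ 0" M] M[of 0 0] by simp
    show "norm (F $ k $ l) \<le> M / r ^ (k + l)" for k l
      using M[of k l] assms(2) by (simp add: field_simps)
  qed
qed

lemma geometric_bound_mono:
  assumes "geometric_bound r F" "0 \<le> r'" "r' \<le> r"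
  shows "geometric_bound r' F"
proof -
  obtain M where M: "\<And>k l. norm (F $ k $ l) * r ^ (k + l) \<le> M"
    using assms(1) unfolding geometric_bound_def by blast
  have "norm (F $ k $ l) * r' ^ (k + l) \<le> M" for k l
    using assms(2,3) by (intro order_trans[OF mult_left_mono[OF power_mono] M]) auto
  thus ?thesis unfolding geometric_bound_def by blast
qed

lemma double_geometric_summable:
  fixes x y :: real
  assumes "0 \<le> x" "x < 1" "0 \<le> y" "y < 1"
  shows "(\<lambda>(k, l). x ^ k * y ^ l) summable_on UNIV"
proof -
  have y: "((\<lambda>l. x ^ k * y ^ l) has_sum x ^ k * (1 / (1 - y))) UNIV" for k
    using assms by (intro has_sum_cmult_right norm_summable_imp_has_sum geometric_sums)
      (auto simp: norm_power intro!: summable_geometric)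
  have x: "((\<lambda>k. x ^ k * (1 / (1 - y))) has_sum 1 / (1 - x) * (1 / (1 - y))) UNIV"
    using assms by (intro has_sum_cmult_left norm_summable_imp_has_sum geometric_sums)
      (auto simp: norm_power intro!: summable_geometric)
  have "(\<lambda>p. norm (case p of (k, l) \<Rightarrow> x ^ k * y ^ l)) summable_on UNIV \<times> UNIV"
    unfolding Infinite_Sum.abs_summable_on_Sigma_iff
  proof (intro conjI ballI)
    show "(\<lambda>l. norm (case (k, l) of (k, l) \<Rightarrow> x ^ k * y ^ l)) summable_on UNIV" for k
      using has_sum_imp_summable[OF y[of k]] assms by simp
    have "infsum (\<lambda>l. norm (case (k, l) of (k, l) \<Rightarrow> x ^ k * y ^ l)) UNIV = x ^ k * (1 / (1 - y))" for k
      using infsumI[OF y[of k]] assms by simp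
    thus "(\<lambda>k. norm (infsum (\<lambda>l. norm (case (k, l) of (k, l) \<Rightarrow> x ^ k * y ^ l)) UNIV)) summable_on UNIV"
      using has_sum_imp_summable[OF x] assms by simp
  qed
  thus ?thesis using abs_summable_summable[of "\<lambda>(k, l). x ^ k * y ^ l" UNIV] by simp
qed

text \<open>
  Comparison with the double geometric series in \<open>|u| / r\<close> and \<open>|z| / r\<close>.
\<close>

lemma geometric_bound_abs_summable:
  assumes "geometric_bound r F" "norm u < r" "norm z < r"
  shows "(\<lambda>(k, l). norm (F $ k $ l * u ^ k * z ^ l)) summable_on UNIV"
proof -
  have r: "r > 0" using assms(2) norm_ge_zero[of u] by linarith
  obtain M where M: "M \<ge> 0" "\<And>k l. norm (F $ k $ l) \<le> M / r ^ (k + l)"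
    using geometric_boundD[OF assms(1) r] by blast
  have sg: "(\<lambda>(k, l). (norm u / r) ^ k * (norm z / r) ^ l) summable_on UNIV"
    using r assms by (intro double_geometric_summable) auto
  have "(\<lambda>x. M * (case x of (k, l) \<Rightarrow> (norm u / r) ^ k * (norm z / r) ^ l)) summable_on UNIV"
    by (intro summable_on_cmult_right sg)
  hence "(\<lambda>x. norm (case x of (k, l) \<Rightarrow> F $ k $ l * u ^ k * z ^ l)) summable_on UNIV"
  proof (rule Infinite_Sum.abs_summable_on_comparison_test', goal_cases)
    case (1 x)
    obtain k l where x: "x = (k, l)" by (cases x)
    have "norm (F $ k $ l * u ^ k * z ^ l) \<le> M / r ^ (k + l) * norm u ^ k * norm z ^ l"
      unfolding norm_mult norm_power using M by (intro mult_right_mono) auto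
    thus ?case by (simp add: x power_add power_divide mult_ac)
  qed
  thus ?thesis by (simp add: case_prod_unfold)
qed

lemma geometric_bound_conv_radius:
  assumes "geometric_bound r F"
  shows "ereal r \<le> fps_conv_radius (F $ k)"
  unfolding fps_conv_radius_def
proof (rule conv_radius_geI_ex')
  fix \<rho> :: real assume \<rho>: "0 < \<rho>" "ereal \<rho> < ereal r"
  have "(\<lambda>p. norm (case p of (k, l) \<Rightarrow> F $ k $ l * of_real \<rho> ^ k * of_real \<rho> ^ l)) summable_on UNIV \<times> UNIV"
    using geometric_bound_abs_summable[OF assms, of "of_real \<rho>" "of_real \<rho>"] \<rho>
    by (simp add: case_prod_unfold)
  hence "(\<lambda>l. norm (F $ k $ l * of_real \<rho> ^ k * of_real \<rho> ^ l)) summable_on UNIV"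
    unfolding Infinite_Sum.abs_summable_on_Sigma_iff by simp
  hence "(\<lambda>l. F $ k $ l * of_real \<rho> ^ k * of_real \<rho> ^ l) summable_on UNIV"
    by (rule abs_summable_summable)
  hence "summable (\<lambda>l. of_real \<rho> ^ k * (F $ k $ l * of_real \<rho> ^ l))"
    using summable_on_imp_summable by (simp add: mult_ac)
  thus "summable (\<lambda>l. F $ k $ l * of_real \<rho> ^ l)"
    using \<rho> by (subst (asm) summable_cmult_iff) auto
qed

lemma ereal_less_leI: "a < r \<Longrightarrow> ereal r \<le> R \<Longrightarrow> ereal a < R"
  by (rule less_le_trans[of _ "ereal r"]) auto

lemma row_has_sum:
  assumes "norm z < fps_conv_radius (F $ k)"
  shows "((\<lambda>l. F $ k $ l * u ^ k * z ^ l) has_sum row_sums F z $ k * u ^ k) UNIV"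
proof -
  have "((\<lambda>l. F $ k $ l * z ^ l) has_sum eval_fps (F $ k) z) UNIV"
    using norm_summable_fps[OF assms] sums_eval_fps[OF assms] by (rule norm_summable_imp_has_sum)
  from has_sum_cmult_left[OF this, of "u ^ k"] show ?thesis
    by (simp add: row_sums_def mult_ac)
qed

lemma row_sums_has_sum:
  assumes "((\<lambda>(k, l). F $ k $ l * u ^ k * z ^ l) has_sum S) UNIV" "\<And>k. norm z < fps_conv_radius (F $ k)"
  shows "((\<lambda>k. row_sums F z $ k * u ^ k) has_sum S) UNIV"
proof (rule has_sum_SigmaD)
  show "((\<lambda>(k, l). F $ k $ l * u ^ k * z ^ l) has_sum S) (Sigma UNIV (\<lambda>_. UNIV))" using assms by simp
  show "((\<lambda>l. case (k, l) of (k, l) \<Rightarrow> F $ k $ l * u ^ k * z ^ l) has_sum row_sums F z $ k * u ^ k) UNIV" for k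
    using row_has_sum[OF assms(2)] by simp
qed

text \<open>
  The unordered double sum agrees with the evaluation in two stages, by absolute convergence. This is
  what makes the evaluation symmetric in \<open>u\<close> and \<open>z\<close>.
\<close>

lemma has_sum_eval2:
  assumes "geometric_bound r F" "norm u < r" "norm z < r"
  shows "((\<lambda>(k, l). F $ k $ l * u ^ k * z ^ l) has_sum eval2 F u z) UNIV"
proof -
  have "(\<lambda>p. norm (case p of (k, l) \<Rightarrow> F $ k $ l * u ^ k * z ^ l)) summable_on UNIV"
    using geometric_bound_abs_summable[OF assms] by (simp add: case_prod_unfold)
  hence "(\<lambda>(k, l). F $ k $ l * u ^ k * z ^ l) summable_on UNIV"
    by (rule abs_summable_summable)
  then obtain S where S: "((\<lambda>(k, l). F $ k $ l * u ^ k * z ^ l) has_sum S) UNIV"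
    by (auto simp: summable_on_def)
  have "norm z < fps_conv_radius (F $ k)" for k
    using geometric_bound_conv_radius[OF assms(1), of k] assms(3)
    by (auto intro: ereal_less_leI)
  hence "((\<lambda>k. row_sums F z $ k * u ^ k) has_sum S) UNIV" using S by (intro row_sums_has_sum)
  hence "S = eval2 F u z"
    unfolding eval2_def eval_fps_def using has_sum_imp_sums sums_unique by blast
  thus ?thesis using S by simp
qed

text \<open>
  The condition on the radii of convergence under which both stages of the evaluation are
  legitimate. In contrast to a bound on the coefficients for a fixed \<open>r\<close>, it is preserved by products
  without shrinking \<open>r\<close>.
\<close>

definition regular :: "real \<Rightarrow> complex fps fps \<Rightarrow> bool" where
  "regular r F \<longleftrightarrow> (\<forall>k. ereal r \<le> fps_conv_radius (F $ k)) \<and>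
     (\<forall>z. norm z < r \<longrightarrow> ereal r \<le> fps_conv_radius (row_sums F z))"

lemma geometric_bound_regular:
  assumes "geometric_bound r F"
  shows "regular r F"
  unfolding regular_def
proof (intro conjI allI impI geometric_bound_conv_radius[OF assms])
  fix z :: complex assume z: "norm z < r"
  show "ereal r \<le> fps_conv_radius (row_sums F z)"
    unfolding fps_conv_radius_def
  proof (rule conv_radius_geI_ex')
    fix \<rho> :: real assume \<rho>: "0 < \<rho>" "ereal \<rho> < ereal r"
    have "norm z < fps_conv_radius (F $ k)" for k
      using geometric_bound_conv_radius[OF assms(1), of k] z
      by (auto intro: ereal_less_leI)
    hence "((\<lambda>k. row_sums F z $ k * of_real \<rho> ^ k) has_sum eval2 F (of_real \<rho>) z) UNIV"
      using \<rho> by (intro row_sums_has_sum has_sum_eval2[OF assms] z) auto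
    thus "summable (\<lambda>k. row_sums F z $ k * of_real \<rho> ^ k)"
      using has_sum_imp_sums sums_summable by blast
  qed
qed

lemma regular_row:
  assumes "regular r F" "norm (z :: complex) < r"
  shows "ereal (norm z) < fps_conv_radius (F $ k)"
  using assms unfolding regular_def
  by (auto intro: ereal_less_leI)

lemma regular_column:
  assumes "regular r F" "norm z < r" "norm (u :: complex) < r"
  shows "ereal (norm u) < fps_conv_radius (row_sums F z)"
  using assms unfolding regular_def
  by (auto intro: ereal_less_leI)

text \<open>
  The induction needs the radius of convergence of the partial sums, hence the conjunction.
\<close>

lemma eval_fps_sum:
  assumes "finite A" "\<And>i. i \<in> A \<Longrightarrow> ereal (norm z) < fps_conv_radius (f i)"
  shows "eval_fps (\<Sum>i\<in>A. f i) z = (\<Sum>i\<in>A. eval_fps (f i :: complex fps) z) \<and>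
    ereal (norm z) < fps_conv_radius (\<Sum>i\<in>A. f i)"
  using assms
proof (induction A rule: finite_induct)
  case (insert i A)
  hence "ereal (norm z) < min (fps_conv_radius (f i)) (fps_conv_radius (\<Sum>i\<in>A. f i))" by simp
  hence "ereal (norm z) < fps_conv_radius (f i + (\<Sum>i\<in>A. f i))"
    using fps_conv_radius_add less_le_trans by blast
  with insert show ?case by (simp add: eval_fps_add)
qed simp

lemma row_sums_add:
  assumes "regular r F" "regular r G" "norm z < r"
  shows "row_sums (F + G) z = row_sums F z + row_sums G z"
  using assms by (simp add: fps_eq_iff row_sums_def eval_fps_add regular_row)

lemma regular_add:
  assumes "regular r F" "regular r G"
  shows "regular r (F + G)"
  unfolding regular_def
proof (intro conjI allI impI)
  show "ereal r \<le> fps_conv_radius ((F + G) $ k)" for k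
    using assms fps_conv_radius_add[of "F $ k" "G $ k"] unfolding regular_def
    by (metis fps_add_nth min.boundedI order_trans)
  show "ereal r \<le> fps_conv_radius (row_sums (F + G) z)" if "norm z < r" for z
    using assms that fps_conv_radius_add[of "row_sums F z" "row_sums G z"] unfolding row_sums_add[OF assms that]
    unfolding regular_def by (metis min.boundedI order_trans)
qed

lemma fps_conv_radius_sum:
  assumes "finite A" "\<And>i. i \<in> A \<Longrightarrow> R \<le> fps_conv_radius (f i :: complex fps)"
  shows "R \<le> fps_conv_radius (\<Sum>i\<in>A. f i)"
  using assms
proof (induction A rule: finite_induct)
  case (insert i A)
  hence "R \<le> min (fps_conv_radius (f i)) (fps_conv_radius (\<Sum>i\<in>A. f i))" by simp
  also have "\<dots> \<le> fps_conv_radius (f i + (\<Sum>i\<in>A. f i))" by (rule fps_conv_radius_add)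
  finally show ?case using insert by simp
qed simp

lemma fps_conv_radius_mult_ge:
  assumes "R \<le> fps_conv_radius f" "R \<le> fps_conv_radius (g :: complex fps)"
  shows "R \<le> fps_conv_radius (f * g)"
  using assms fps_conv_radius_mult[of f g] by (meson min.boundedI order_trans)

lemma row_sums_mult:
  assumes "regular r F" "regular r G" "norm z < r"
  shows "row_sums (F * G) z = row_sums F z * row_sums G z"
proof (rule fps_ext)
  fix n :: nat
  have "ereal (norm z) < fps_conv_radius (F $ i * G $ j)" for i j
    using assms fps_conv_radius_mult[of "F $ i" "G $ j"]
    by (meson less_le_trans min_less_iff_conj regular_row)
  hence "eval_fps (\<Sum>i=0..n. F $ i * G $ (n - i)) z = (\<Sum>i=0..n. eval_fps (F $ i * G $ (n - i)) z)"
    using eval_fps_sum[of "{0..n}" z "\<lambda>i. F $ i * G $ (n - i)"] by blast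
  also have "\<dots> = (\<Sum>i=0..n. eval_fps (F $ i) z * eval_fps (G $ (n - i)) z)"
    using assms by (simp add: eval_fps_mult regular_row)
  finally show "row_sums (F * G) z $ n = (row_sums F z * row_sums G z) $ n"
    by (simp add: row_sums_def fps_mult_nth)
qed

lemma regular_mult:
  assumes "regular r F" "regular r G"
  shows "regular r (F * G)"
  unfolding regular_def
proof (intro conjI allI impI)
  show "ereal r \<le> fps_conv_radius ((F * G) $ k)" for k
    unfolding fps_mult_nth using assms
    by (intro fps_conv_radius_sum fps_conv_radius_mult_ge) (auto simp: regular_def)
  show "ereal r \<le> fps_conv_radius (row_sums (F * G) z)" if "norm z < r" for z
    unfolding row_sums_mult[OF assms that] using assms that
    by (intro fps_conv_radius_mult_ge) (auto simp: regular_def)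
qed

lemma row_sums_const: "row_sums (fps_const f) z = fps_const (eval_fps f z)"
  by (simp add: fps_eq_iff row_sums_def)

lemma row_sums_X: "row_sums fps_X z = fps_X"
  by (simp add: fps_eq_iff row_sums_def fps_X_def)

lemma regular_const: "regular r (fps_const (fps_const s))"
  by (simp add: regular_def row_sums_const)

lemma regular_X: "regular r fps_X"
  by (simp add: regular_def row_sums_X fps_X_nth)

lemma eval2_add:
  assumes "regular r F" "regular r G" "norm u < r" "norm z < r"
  shows "eval2 (F + G) u z = eval2 F u z + eval2 G u z"
  using assms by (simp add: eval2_def row_sums_add eval_fps_add regular_column)

lemma eval2_mult:
  assumes "regular r F" "regular r G" "norm u < r" "norm z < r"
  shows "eval2 (F * G) u z = eval2 F u z * eval2 G u z"
  using assms by (simp add: eval2_def row_sums_mult eval_fps_mult regular_column)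

lemma eval2_const: "eval2 (fps_const (fps_const s)) u z = s"
  by (simp add: eval2_def row_sums_const)

lemma eval2_X: "eval2 fps_X u z = u"
  by (simp add: eval2_def row_sums_X)

lemma eval2_0_0: "eval2 F 0 0 = F $ 0 $ 0"
  by (simp add: eval2_def row_sums_def eval_fps_at_0)

text \<open>
  Injectivity of the evaluation: for fixed small \<open>z\<close> the series in \<open>u\<close> vanishes identically, so each
  row vanishes at each small \<open>z\<close>, and then each row is zero.
\<close>

lemma eval2_eq_0D:
  assumes F: "regular r F" and r: "0 < \<rho>" "\<rho> \<le> r"
    and zero: "\<And>u z. norm u < \<rho> \<Longrightarrow> norm z < \<rho> \<Longrightarrow> eval2 F u z = 0"
  shows "F = 0"
proof -
  have rpos: "(0::ereal) < ereal r" using r by simp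
  have row: "row_sums F z = 0" if z: "norm z < \<rho>" for z
  proof (rule eval_fps_eqD)
    show "fps_conv_radius (row_sums F z) > 0"
      using F z r rpos unfolding regular_def by (meson less_le_trans)
    show "\<forall>\<^sub>F u in nhds 0. eval_fps (row_sums F z) u = eval_fps 0 u"
      unfolding eventually_nhds_metric using zero z r(1) by (auto simp: eval2_def)
  qed simp
  have "F $ k = 0" for k
  proof (rule eval_fps_eqD)
    show "fps_conv_radius (F $ k) > 0"
      using F rpos unfolding regular_def by (meson less_le_trans)
    have "eval_fps (F $ k) z = 0" if "norm z < \<rho>" for z
      using row[OF that] by (simp add: fps_eq_iff row_sums_def)
    thus "\<forall>\<^sub>F z in nhds 0. eval_fps (F $ k) z = eval_fps 0 z"
      unfolding eventually_nhds_metric using r(1) by auto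
  qed simp
  thus ?thesis by (simp add: fps_eq_iff)
qed

lemma eventually_nhds_bidisc:
  "(\<forall>\<^sub>F (u, z) in nhds (0 :: complex, 0 :: complex). Q u z) \<longleftrightarrow>
     (\<exists>r>0. \<forall>u z. norm u < r \<longrightarrow> norm z < r \<longrightarrow> Q u z)"
proof
  assume "\<forall>\<^sub>F (u, z) in nhds (0, 0). Q u z"
  then obtain A B where AB: "eventually A (nhds 0)" "eventually B (nhds 0)"
    "\<And>u z. A u \<Longrightarrow> B z \<Longrightarrow> Q u z"
    unfolding nhds_prod eventually_prod_filter by auto
  then obtain a b where "a > 0" "\<And>u. norm u < a \<Longrightarrow> A u" "b > 0" "\<And>z. norm z < b \<Longrightarrow> B z"
    unfolding eventually_nhds_metric by auto
  with AB(3) show "\<exists>r>0. \<forall>u z. norm u < r \<longrightarrow> norm z < r \<longrightarrow> Q u z"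
    by (intro exI[of _ "min a b"]) auto
next
  assume "\<exists>r>0. \<forall>u z. norm u < r \<longrightarrow> norm z < r \<longrightarrow> Q u z"
  then obtain r where r: "r > 0" "\<And>u z. norm u < r \<Longrightarrow> norm z < r \<Longrightarrow> Q u z" by blast
  have "\<forall>\<^sub>F u in nhds 0. norm (u :: complex) < r"
    unfolding eventually_nhds_metric using r(1) by auto
  with r(2) show "\<forall>\<^sub>F (u, z) in nhds (0, 0). Q u z"
    unfolding nhds_prod eventually_prod_filter by auto
qed

section \<open>Functions represented by double series\<close>

definition represents :: "complex fps fps \<Rightarrow> (complex \<Rightarrow> complex \<Rightarrow> complex) \<Rightarrow> bool" where
  "represents F \<psi> \<longleftrightarrow> (\<exists>r>0. geometric_bound r F \<and>
     (\<forall>u z. norm u < r \<longrightarrow> norm z < r \<longrightarrow> \<psi> u z = eval2 F u z))"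

text \<open>
  Convergence at one point \<open>(r, r)\<close> with \<open>r > 0\<close> already bounds the coefficients, because over the
  complex numbers unordered summability is absolute and the terms are bounded by the sum of their
  norms.
\<close>

lemma represents_iff_has_sum:
  "represents F \<psi> \<longleftrightarrow> (\<forall>\<^sub>F (u, z) in nhds (0, 0).
     ((\<lambda>(k, l). F $ k $ l * u ^ k * z ^ l) has_sum \<psi> u z) UNIV)"
proof
  assume "represents F \<psi>"
  then obtain r where r: "r > 0" "geometric_bound r F"
      "\<And>u z. norm u < r \<Longrightarrow> norm z < r \<Longrightarrow> \<psi> u z = eval2 F u z"
    unfolding represents_def by blast
  have "((\<lambda>(k, l). F $ k $ l * u ^ k * z ^ l) has_sum \<psi> u z) UNIV"
    if "norm u < r" "norm z < r" for u z
    using has_sum_eval2[OF r(2) that] r(3)[OF that] by simp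
  with r(1) show "\<forall>\<^sub>F (u, z) in nhds (0, 0).
      ((\<lambda>(k, l). F $ k $ l * u ^ k * z ^ l) has_sum \<psi> u z) UNIV"
    unfolding eventually_nhds_bidisc by blast
next
  assume "\<forall>\<^sub>F (u, z) in nhds (0, 0). ((\<lambda>(k, l). F $ k $ l * u ^ k * z ^ l) has_sum \<psi> u z) UNIV"
  then obtain R where R: "R > 0"
    "\<And>u z. norm u < R \<Longrightarrow> norm z < R \<Longrightarrow> ((\<lambda>(k, l). F $ k $ l * u ^ k * z ^ l) has_sum \<psi> u z) UNIV"
    unfolding eventually_nhds_bidisc by blast
  define r where "r = R / 2"
  have r: "0 < r" "r < R" using R(1) by (simp_all add: r_def)
  define f where "f = (\<lambda>(k, l). F $ k $ l * of_real r ^ k * of_real r ^ l)"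
  have "f summable_on UNIV"
    using has_sum_imp_summable[OF R(2)[of "of_real r" "of_real r"]] r by (simp add: f_def)
  hence f: "(\<lambda>x. norm (f x)) summable_on UNIV"
    by (simp add: summable_on_iff_abs_summable_on_complex)
  have "norm (F $ k $ l) * r ^ (k + l) \<le> infsum (\<lambda>x. norm (f x)) UNIV" for k l
  proof -
    have "norm (F $ k $ l) * r ^ (k + l) = (\<Sum>x\<in>{(k, l)}. norm (f x))"
      using r by (simp add: f_def norm_mult norm_power power_add)
    also have "\<dots> \<le> infsum (\<lambda>x. norm (f x)) UNIV"
      by (rule finite_sum_le_infsum[OF f]) auto
    finally show ?thesis .
  qed
  hence gb: "geometric_bound r F" unfolding geometric_bound_def by blast
  have "\<psi> u z = eval2 F u z" if "norm u < r" "norm z < r" for u z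
    using has_sum_unique[OF R(2) has_sum_eval2[OF gb that]] that r by simp
  with gb r(1) show "represents F \<psi>" unfolding represents_def by blast
qed

text \<open>
  Halving the radius absorbs the factor \<open>k + 1\<close>, since \<open>k + 1 \<le> 2\<^sup>k\<close>.
\<close>

lemma geometric_bound_du:
  assumes "geometric_bound r F" "r > 0"
  shows "geometric_bound (r / 2) (fps_du F)"
proof -
  obtain M where M: "M \<ge> 0" "\<And>k l. norm (F $ k $ l) \<le> M / r ^ (k + l)"
    using geometric_boundD[OF assms] by blast
  have "norm (fps_du F $ k $ l) * (r / 2) ^ (k + l) \<le> M / r" for k l
  proof -
    have "fps_du F $ k $ l = of_nat (Suc k) * F $ Suc k $ l"
      by (simp add: fps_du_def fps_of_nat [symmetric] del: of_nat_Suc)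
    hence "norm (fps_du F $ k $ l) = of_nat (Suc k) * norm (F $ Suc k $ l)"
      by (simp add: norm_mult del: of_nat_Suc)
    also have "\<dots> \<le> 2 ^ (k + l) * (M / r ^ (Suc k + l))"
    proof (intro mult_mono M)
      have "Suc k \<le> 2 ^ k" by (simp add: Suc_leI)
      also have "\<dots> \<le> 2 ^ (k + l)" by simp
      finally have "real (Suc k) \<le> real (2 ^ (k + l))" by (rule of_nat_mono)
      thus "real (Suc k) \<le> 2 ^ (k + l)" by simp
    qed auto
    finally have "norm (fps_du F $ k $ l) * (r / 2) ^ (k + l) \<le> 2 ^ (k + l) * (M / r ^ (Suc k + l)) * (r / 2) ^ (k + l)"
      using assms(2) by (intro mult_right_mono) auto
    also have "\<dots> = M / r" using assms(2) by (simp add: power_divide)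
    finally show ?thesis .
  qed
  thus ?thesis unfolding geometric_bound_def by blast
qed

lemma row_sums_du:
  assumes "regular r F" "norm z < r"
  shows "row_sums (fps_du F) z = fps_deriv (row_sums F z)"
proof (rule fps_ext)
  fix k :: nat
  have "fps_du F $ k = fps_const (of_nat (Suc k)) * F $ Suc k"
    by (simp add: fps_du_def fps_of_nat del: of_nat_Suc)
  hence "eval_fps (fps_du F $ k) z = of_nat (Suc k) * eval_fps (F $ Suc k) z"
    using regular_row[OF assms] by (simp add: eval_fps_mult del: of_nat_Suc)
  thus "row_sums (fps_du F) z $ k = fps_deriv (row_sums F z) $ k"
    by (simp add: row_sums_def)
qed

lemma represents_partial_u:
  assumes "represents F \<psi>"
  shows "represents (fps_du F) (partial_u \<psi>)"
proof -
  obtain r where r: "r > 0" "geometric_bound r F"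
    and eq: "\<And>u z. norm u < r \<Longrightarrow> norm z < r \<Longrightarrow> \<psi> u z = eval2 F u z"
    using assms unfolding represents_def by blast
  have reg: "regular r F" by (rule geometric_bound_regular[OF r(2)])
  have "partial_u \<psi> u z = eval2 (fps_du F) u z" if u: "norm u < r" and z: "norm z < r" for u z
  proof -
    have "\<forall>\<^sub>F v in nhds u. v \<in> ball 0 r"
      using u by (intro eventually_nhds_in_open) auto
    hence "\<forall>\<^sub>F v in nhds u. \<psi> v z = eval_fps (row_sums F z) v"
      by eventually_elim (use eq z in \<open>auto simp: eval2_def\<close>)
    hence "partial_u \<psi> u z = deriv (eval_fps (row_sums F z)) u"
      unfolding partial_u_def by (intro deriv_cong_ev refl)
    also have "\<dots> = eval_fps (fps_deriv (row_sums F z)) u"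
      using regular_column[OF reg z u] by (simp add: eval_fps_deriv)
    finally show ?thesis by (simp add: eval2_def row_sums_du[OF reg z])
  qed
  with geometric_bound_du[OF r(2,1)] r(1) show ?thesis
    unfolding represents_def by (intro exI[of _ "r / 2"]) auto
qed

text \<open>
  Differentiation in \<open>z\<close> is reduced to differentiation in \<open>u\<close> by exchanging the variables; this is
  legitimate since the unordered double sum does not depend on their order.
\<close>

definition fps_transpose :: "complex fps fps \<Rightarrow> complex fps fps" where
  "fps_transpose F = Abs_fps (\<lambda>l. Abs_fps (\<lambda>k. F $ k $ l))"

lemma represents_transpose:
  assumes "represents F \<psi>"
  shows "represents (fps_transpose F) (\<lambda>z u. \<psi> u z)"
proof -
  obtain R where R: "R > 0"
    "\<And>u z. norm u < R \<Longrightarrow> norm z < R \<Longrightarrow> ((\<lambda>(k, l). F $ k $ l * u ^ k * z ^ l) has_sum \<psi> u z) UNIV"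
    using assms unfolding represents_iff_has_sum eventually_nhds_bidisc by blast
  have "((\<lambda>(l, k). fps_transpose F $ l $ k * z ^ l * u ^ k) has_sum \<psi> u z) UNIV"
    if "norm u < R" "norm z < R" for u z
    using R(2)[OF that] has_sum_swap[where f = "\<lambda>(k, l). F $ k $ l * u ^ k * z ^ l" and S = "\<psi> u z" and A = UNIV and B = UNIV]
    by (simp add: fps_transpose_def mult_ac)
  with R(1) show ?thesis unfolding represents_iff_has_sum eventually_nhds_bidisc by blast
qed

lemma represents_partial_z:
  assumes "represents F \<psi>"
  shows "represents (fps_dz F) (partial_z \<psi>)"
proof -
  have "represents (fps_transpose (fps_du (fps_transpose F))) (\<lambda>u z. partial_u (\<lambda>z u. \<psi> u z) z u)"
    by (intro represents_transpose represents_partial_u assms)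
  moreover have "fps_transpose (fps_du (fps_transpose F)) = fps_dz F"
    by (simp add: fps_eq_iff fps_transpose_def fps_du_def fps_dz_def fps_of_nat [symmetric] del: of_nat_Suc)
  moreover have "(\<lambda>u z. partial_u (\<lambda>z u. \<psi> u z) z u) = partial_z \<psi>"
    by (simp add: fun_eq_iff partial_u_def partial_z_def)
  ultimately show ?thesis by simp
qed

lemma represents_deriv_at_origin:
  assumes "represents F \<psi>"
  shows "deriv_at_origin \<psi> k l = fps_deriv_at_origin F k l"
proof -
  have "represents ((fps_dz ^^ l) F) ((partial_z ^^ l) \<psi>)"
    by (induction l) (auto intro: assms represents_partial_z)
  hence "represents ((fps_du ^^ k) ((fps_dz ^^ l) F)) ((partial_u ^^ k) ((partial_z ^^ l) \<psi>))"
    by (induction k) (auto intro: represents_partial_u)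
  thus ?thesis
    by (auto simp: represents_def deriv_at_origin_def fps_deriv_at_origin_def eval2_0_0)
qed

lemma represents_common_radius:
  assumes "represents F \<psi>"
  obtains r where "r > 0" "regular r F"
    "\<And>u z. norm u < r \<Longrightarrow> norm z < r \<Longrightarrow> \<psi> u z = eval2 F u z"
  using assms geometric_bound_regular unfolding represents_def by blast

lemma regular_mono:
  assumes "regular r F" "r' \<le> r"
  shows "regular r' F"
proof -
  have "ereal r' \<le> ereal r" using assms(2) by simp
  thus ?thesis using assms unfolding regular_def by (meson less_le_trans order_trans)
qed

text \<open>
  The left-hand side of the equation is the value of a formal double series, which vanishes near the
  origin exactly if the series is zero.
\<close>

lemma represents_pde_iff:
  assumes "represents F \<psi>"
  shows "(\<forall>\<^sub>F (u, z) in nhds (0, 0).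
        \<sigma> * \<psi> u z * partial_u \<psi> u z + u * (partial_u \<psi> u z)\<^sup>2
          + 1/2 * (partial_z \<psi> u z)\<^sup>2 = 0) \<longleftrightarrow>
     fps_const (fps_const \<sigma>) * F * fps_du F + fps_X * (fps_du F)\<^sup>2
       + fps_const (fps_const (1/2)) * (fps_dz F)\<^sup>2 = 0" (is "?L \<longleftrightarrow> ?P = 0")
proof -
  obtain r1 where r1: "r1 > 0" "regular r1 F"
    "\<And>u z. norm u < r1 \<Longrightarrow> norm z < r1 \<Longrightarrow> \<psi> u z = eval2 F u z"
    using represents_common_radius[OF assms] by blast
  obtain r2 where r2: "r2 > 0" "regular r2 (fps_du F)"
    "\<And>u z. norm u < r2 \<Longrightarrow> norm z < r2 \<Longrightarrow> partial_u \<psi> u z = eval2 (fps_du F) u z"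
    using represents_common_radius[OF represents_partial_u[OF assms]] by blast
  obtain r3 where r3: "r3 > 0" "regular r3 (fps_dz F)"
    "\<And>u z. norm u < r3 \<Longrightarrow> norm z < r3 \<Longrightarrow> partial_z \<psi> u z = eval2 (fps_dz F) u z"
    using represents_common_radius[OF represents_partial_z[OF assms]] by blast
  define r where "r = min r1 (min r2 r3)"
  have r: "r > 0" using r1(1) r2(1) r3(1) by (simp add: r_def)
  have reg: "regular r F" "regular r (fps_du F)" "regular r (fps_dz F)"
    using r1(2) r2(2) r3(2) by (auto intro: regular_mono simp: r_def)
  note regs = regular_mult regular_add regular_const regular_X reg
  have P: "regular r ?P"
    unfolding power2_eq_square by (intro regs)
  have eval: "eval2 ?P u z = \<sigma> * \<psi> u z * partial_u \<psi> u z + u * (partial_u \<psi> u z)\<^sup>2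
          + 1/2 * (partial_z \<psi> u z)\<^sup>2" if uz: "norm u < r" "norm z < r" for u z
  proof -
    have "\<psi> u z = eval2 F u z" "partial_u \<psi> u z = eval2 (fps_du F) u z"
      "partial_z \<psi> u z = eval2 (fps_dz F) u z"
      using uz by (auto intro: r1(3) r2(3) r3(3) simp: r_def)
    thus ?thesis
      unfolding power2_eq_square
      by (simp add: eval2_add[OF _ _ uz] eval2_mult[OF _ _ uz] eval2_const eval2_X regs)
  qed
  show ?thesis
  proof
    assume ?L
    then obtain s where s: "s > 0" "\<And>u z. norm u < s \<Longrightarrow> norm z < s \<Longrightarrow>
        \<sigma> * \<psi> u z * partial_u \<psi> u z + u * (partial_u \<psi> u z)\<^sup>2 + 1/2 * (partial_z \<psi> u z)\<^sup>2 = 0"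
      unfolding eventually_nhds_bidisc by blast
    show "?P = 0"
      by (rule eval2_eq_0D[OF P, of "min r s"]) (use r s eval in auto)
  next
    assume "?P = 0"
    moreover have "eval2 0 u z = 0" for u z
      using eval2_const[of 0 u z] by simp
    ultimately show ?L
      unfolding eventually_nhds_bidisc using r eval by auto
  qed
qed

lemma analytic_solution_iff_formal:
  "analytic_solution \<sigma> c \<psi> \<longleftrightarrow> (\<exists>F. represents F \<psi> \<and> formal_solution \<sigma> c F)"
proof
  assume sol: "analytic_solution \<sigma> c \<psi>"
  then obtain a where "\<forall>\<^sub>F (u, z) in nhds (0, 0).
        ((\<lambda>(k, l). a k l * u ^ k * z ^ l) has_sum \<psi> u z) UNIV"
    unfolding analytic_solution_def by blast
  hence rep: "represents (Abs_fps (\<lambda>k. Abs_fps (a k))) \<psi>"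
    by (simp add: represents_iff_has_sum)
  with sol show "\<exists>F. represents F \<psi> \<and> formal_solution \<sigma> c F"
    unfolding analytic_solution_def formal_solution_def represents_pde_iff[OF rep]
      represents_deriv_at_origin[OF rep] by blast
next
  assume "\<exists>F. represents F \<psi> \<and> formal_solution \<sigma> c F"
  then obtain F where F: "represents F \<psi>" "formal_solution \<sigma> c F" by blast
  have "\<exists>a. \<forall>\<^sub>F (u, z) in nhds (0, 0). ((\<lambda>(k, l). a k l * u ^ k * z ^ l) has_sum \<psi> u z) UNIV"
    using F(1) unfolding represents_iff_has_sum by (rule exI[of _ "\<lambda>k l. F $ k $ l"])
  with F(2) show "analytic_solution \<sigma> c \<psi>"
    unfolding analytic_solution_def formal_solution_def represents_pde_iff[OF F(1)]
      represents_deriv_at_origin[OF F(1)] by blast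
qed

section \<open>Convergence of the similarity series\<close>

text \<open>
  The quotient is at most the central binomial coefficient.
\<close>

lemma central_fact_bound:
  assumes "j \<le> m"
  shows "norm (fact (2 * j) / (fact m * fact j) :: complex) \<le> 4 ^ j"
proof -
  have "fact (2 * j) / (fact j * fact j) = real (2 * j choose j)"
    by (subst binomial_fact) (simp_all add: mult_2)
  also have "\<dots> \<le> 2 ^ (2 * j)"
    using binomial_le_pow2[of "2 * j" j] by (metis of_nat_le_iff of_nat_numeral of_nat_power)
  finally have j: "fact (2 * j) / (fact j * fact j) \<le> (4 ^ j :: real)"
    by (simp add: power_mult)
  have "norm (fact (2 * j) / (fact m * fact j) :: complex) = fact (2 * j) / (fact m * fact j)"
    by (simp add: norm_divide norm_mult)
  also have "\<dots> \<le> fact (2 * j) / (fact j * fact j)"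
    using assms by (intro divide_left_mono mult_right_mono fact_mono) auto
  finally show ?thesis using j by simp
qed

lemma profile_plus_bound: "norm (profile_plus $ k) \<le> 6 ^ k"
proof (cases k)
  case (Suc j)
  have "norm (profile_plus $ k) = (3 / 2) ^ j * norm (fact (2 * j) / (fact (Suc k) * fact j) :: complex)"
    by (simp add: profile_plus_def Suc norm_mult norm_divide norm_power power_divide)
  also have "\<dots> \<le> (3 / 2) ^ j * 4 ^ j"
    using Suc by (intro mult_left_mono central_fact_bound) auto
  also have "\<dots> = 6 ^ j" by (simp flip: power_mult_distrib)
  also have "\<dots> \<le> 6 ^ k" using Suc by simp
  finally show ?thesis .
qed (simp add: profile_plus_def)

lemma profile_minus_bound: "norm (profile_minus $ k) \<le> 6 ^ k"
proof (cases k)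
  case (Suc j)
  have "norm (profile_minus $ k) = (1 / 2) ^ k * norm (fact (2 * j) / (fact k * fact j) :: complex)"
    by (simp add: profile_minus_def Suc norm_mult norm_divide norm_power power_divide)
  also have "\<dots> \<le> 1 * 4 ^ j"
    using Suc by (intro mult_mono central_fact_bound power_le_one) auto
  also have "\<dots> \<le> 6 ^ k"
    unfolding mult_1 Suc by (intro order_trans[OF power_mono power_increasing]) auto
  finally show ?thesis .
qed (simp add: profile_minus_def)

text \<open>
  The binomial coefficient is at most \<open>2\<^sup>l\<^sup>+\<^sup>2\<^sup>k\<close>, so the coefficients are bounded by
  \<open>D\<^sup>l\<^sup>+\<^sup>2\<^sup>k 6\<^sup>k\<close> with \<open>D = 2 (1 + |c|)\<close>, hence by \<open>K\<^sup>k\<^sup>+\<^sup>l\<close> with \<open>K = 6 D\<^sup>2\<close>. The summand \<open>1\<close> in \<open>D\<close> makes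
  \<open>D \<ge> 1\<close>, which gives \<open>D \<le> K\<close>.
\<close>

lemma similarity_series_geometric_bound:
  assumes "\<And>k. norm (P $ k) \<le> 6 ^ k"
  shows "\<exists>r>0. geometric_bound r (similarity_series c P)"
proof -
  define D where "D = 2 * (1 + norm c)"
  define K where "K = 6 * D\<^sup>2"
  have D: "D \<ge> 1" by (simp add: D_def)
  have DK: "D \<le> K"
  proof -
    have "D * 1 \<le> D * D" using D by (intro mult_left_mono) auto
    thus ?thesis using D by (simp add: K_def power2_eq_square)
  qed
  have bound: "norm (similarity_series c P $ k $ l) \<le> K ^ (k + l)" for k l
  proof (cases "k = 0")
    case True
    have "norm (similarity_series c P $ 0 $ l) \<le> norm (initial_row c $ l)"
      using assms[of 0] by (simp add: similarity_series_nth norm_mult mult_left_le_one_le)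
    also have "\<dots> \<le> D ^ l" by (auto simp: initial_row_nth D_def)
    also have "\<dots> \<le> K ^ l" using D DK by (intro power_mono) auto
    finally show ?thesis using True by simp
  next
    case False
    have "norm c ^ (l + 2 * k) * real ((l + 2 * k - 2) choose l) \<le> (1 + norm c) ^ (l + 2 * k) * 2 ^ (l + 2 * k)"
    proof (intro mult_mono power_mono)
      have "(l + 2 * k - 2) choose l \<le> 2 ^ (l + 2 * k - 2)" by (rule binomial_le_pow2)
      also have "\<dots> \<le> 2 ^ (l + 2 * k)" by (intro power_increasing) auto
      finally show "real ((l + 2 * k - 2) choose l) \<le> 2 ^ (l + 2 * k)"
        by (metis of_nat_le_iff of_nat_numeral of_nat_power)
    qed auto
    also have "\<dots> = D ^ (l + 2 * k)" by (simp only: D_def power_mult_distrib mult.commute)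
    finally have "norm (similarity_series c P $ k $ l) \<le> D ^ (l + 2 * k) * 6 ^ k"
      using False assms[of k] by (simp add: similarity_series_nth norm_mult norm_power mult_mono')
    also have "\<dots> = D ^ l * K ^ k" by (simp add: K_def power_add power_mult power_mult_distrib)
    also have "\<dots> \<le> K ^ l * K ^ k" using D DK by (intro mult_right_mono power_mono) auto
    finally show ?thesis by (simp add: power_add mult_ac)
  qed
  have K: "K > 0" using D DK by linarith
  have "geometric_bound (1 / K) (similarity_series c P)"
    unfolding geometric_bound_def
  proof (intro exI allI)
    fix k l
    show "norm (similarity_series c P $ k $ l) * (1 / K) ^ (k + l) \<le> 1"
      using bound[of k l] K by (simp add: power_divide)
  qed
  thus ?thesis using K by (intro exI[of _ "1 / K"]) auto
qed

text \<open>
  Row \<open>0\<close> contributes \<open>1 + c z\<close>; removing it from the sum over the rows leaves \<open>k \<ge> 1\<close>.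
\<close>

lemma eval2_iterated_sum:
  assumes F: "geometric_bound r F" and F0: "F $ 0 = initial_row c" and uz: "norm u < r" "norm z < r"
  shows "eval2 F u z = 1 + c * z + (\<Sum>\<^sub>\<infinity>k\<in>{1..}. \<Sum>\<^sub>\<infinity>l. F $ k $ l * u ^ k * z ^ l)"
proof -
  have row: "norm z < fps_conv_radius (F $ k)" for k
    using regular_row[OF geometric_bound_regular[OF F] uz(2)] .
  have "((\<lambda>k. row_sums F z $ k * u ^ k) has_sum eval2 F u z) UNIV"
    by (intro row_sums_has_sum has_sum_eval2[OF F uz] row)
  moreover have "((\<lambda>k. row_sums F z $ k * u ^ k) has_sum row_sums F z $ 0) {0}"
    using has_sum_finite[of "{0}" "\<lambda>k. row_sums F z $ k * u ^ k"] by simp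
  ultimately have "((\<lambda>k. row_sums F z $ k * u ^ k) has_sum eval2 F u z - row_sums F z $ 0) (UNIV - {0})"
    by (rule has_sum_Diff) simp
  moreover have "UNIV - {0} = {1::nat..}" by auto
  moreover have "row_sums F z $ 0 = 1 + c * z"
    by (simp add: row_sums_def F0 initial_row_def eval_fps_add eval_fps_mult fps_conv_radius_cmult_left less_le_trans[OF _ fps_conv_radius_mult])
  moreover have "(\<Sum>\<^sub>\<infinity>l. F $ k $ l * u ^ k * z ^ l) = row_sums F z $ k * u ^ k" for k
    by (rule infsumI[OF row_has_sum[OF row]])
  ultimately show ?thesis by (simp add: infsumI)
qed

section \<open>Solutions of the two equations\<close>

text \<open>
  The part of the argument that is common to both signs: only the profile and its differential
  equation depend on \<open>\<sigma>\<close>.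
\<close>

lemma solutions_of_profile:
  assumes ode: "similarity_ode \<sigma> P" "P $ 0 = 1" and \<sigma>: "\<sigma> \<noteq> 0" and bound: "\<And>k. norm (P $ k) \<le> 6 ^ k"
    and coeff: "\<And>k l. full_coeff c b k l = similarity_series c P $ k $ l"
  shows "formal_solution \<sigma> c F \<longleftrightarrow> F = Abs_fps (\<lambda>k. Abs_fps (\<lambda>l. full_coeff c b k l))" (is ?formal)
    and "analytic_solution \<sigma> c \<psi> \<longleftrightarrow> (\<forall>\<^sub>F (u, z) in nhds (0, 0).
           \<psi> u z = 1 + c * z + (\<Sum>\<^sub>\<infinity>k\<in>{1..}. \<Sum>\<^sub>\<infinity>l. b k l * u ^ k * z ^ l))" (is ?analytic)
    and "\<forall>\<^sub>F (u, z) in nhds (0, 0).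
        (\<lambda>(k, l). norm (full_coeff c b k l * u ^ k * z ^ l)) summable_on UNIV" (is ?convergent)
proof -
  define S where "S = similarity_series c P"
  have S: "formal_solution \<sigma> c S" unfolding S_def by (rule similarity_series_formal_solution[OF ode])
  have unique: "formal_solution \<sigma> c F \<longleftrightarrow> F = S" for F
    using formal_solution_unique[OF _ S \<sigma>] S by blast
  have S_eq: "S = Abs_fps (\<lambda>k. Abs_fps (\<lambda>l. full_coeff c b k l))"
    by (simp add: S_def coeff fps_eq_iff)
  show ?formal unfolding unique S_eq ..
  obtain r where r: "r > 0" "geometric_bound r S"
    using similarity_series_geometric_bound[OF bound] unfolding S_def by blast
  show ?convergent
    unfolding eventually_nhds_bidisc coeff S_def [symmetric]
    using r geometric_bound_abs_summable by blast
  have S0: "S $ 0 = initial_row c" using S by (simp add: formal_solution_iff)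
  have b: "S $ k $ l = b k l" if "k \<ge> 1" for k l
    using that by (simp add: S_eq full_coeff_def)
  have value_eq: "eval2 S u z = 1 + c * z + (\<Sum>\<^sub>\<infinity>k\<in>{1..}. \<Sum>\<^sub>\<infinity>l. b k l * u ^ k * z ^ l)"
    if "norm u < r" "norm z < r" for u z
    unfolding eval2_iterated_sum[OF r(2) S0 that]
    by (intro arg_cong2[where f = "(+)"] refl infsum_cong) (simp add: b)
  have "analytic_solution \<sigma> c \<psi> \<longleftrightarrow> represents S \<psi>"
    unfolding analytic_solution_iff_formal unique by simp
  also have "\<dots> \<longleftrightarrow> (\<exists>s>0. \<forall>u z. norm u < s \<longrightarrow> norm z < s \<longrightarrow>
      \<psi> u z = 1 + c * z + (\<Sum>\<^sub>\<infinity>k\<in>{1..}. \<Sum>\<^sub>\<infinity>l. b k l * u ^ k * z ^ l))"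
  proof
    assume "represents S \<psi>"
    then obtain s where "s > 0" "\<And>u z. norm u < s \<Longrightarrow> norm z < s \<Longrightarrow> \<psi> u z = eval2 S u z"
      unfolding represents_def by blast
    with r(1) value_eq show "\<exists>s>0. \<forall>u z. norm u < s \<longrightarrow> norm z < s \<longrightarrow>
      \<psi> u z = 1 + c * z + (\<Sum>\<^sub>\<infinity>k\<in>{1..}. \<Sum>\<^sub>\<infinity>l. b k l * u ^ k * z ^ l)"
      by (intro exI[of _ "min r s"]) simp
  next
    assume "\<exists>s>0. \<forall>u z. norm u < s \<longrightarrow> norm z < s \<longrightarrow>
      \<psi> u z = 1 + c * z + (\<Sum>\<^sub>\<infinity>k\<in>{1..}. \<Sum>\<^sub>\<infinity>l. b k l * u ^ k * z ^ l)"
    then obtain s where s: "s > 0" "\<And>u z. norm u < s \<Longrightarrow> norm z < s \<Longrightarrow>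
      \<psi> u z = 1 + c * z + (\<Sum>\<^sub>\<infinity>k\<in>{1..}. \<Sum>\<^sub>\<infinity>l. b k l * u ^ k * z ^ l)"
      by blast
    have "geometric_bound (min r s) S"
      using r s(1) by (intro geometric_bound_mono[OF r(2)]) auto
    with r(1) s value_eq show "represents S \<psi>"
      unfolding represents_def by (intro exI[of _ "min r s"]) simp
  qed
  finally show ?analytic unfolding eventually_nhds_bidisc .
qed

theorem theorem4p1:
  fixes c :: complex
  shows
    "(\<forall>F. formal_solution 1 c F \<longleftrightarrow>
        F = Abs_fps (\<lambda>k. Abs_fps (\<lambda>l. full_coeff c (coeff_plus c) k l))) \<and>
     (\<forall>\<psi>. analytic_solution 1 c \<psi> \<longleftrightarrow>
        (\<forall>\<^sub>F (u, z) in nhds (0, 0).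
           \<psi> u z = 1 + c * z + (\<Sum>\<^sub>\<infinity>k\<in>{1..}. \<Sum>\<^sub>\<infinity>l. coeff_plus c k l * u ^ k * z ^ l))) \<and>
     (\<forall>F. formal_solution (-1) c F \<longleftrightarrow>
        F = Abs_fps (\<lambda>k. Abs_fps (\<lambda>l. full_coeff c (coeff_minus c) k l))) \<and>
     (\<forall>\<psi>. analytic_solution (-1) c \<psi> \<longleftrightarrow>
        (\<forall>\<^sub>F (u, z) in nhds (0, 0).
           \<psi> u z = 1 + c * z + (\<Sum>\<^sub>\<infinity>k\<in>{1..}. \<Sum>\<^sub>\<infinity>l. coeff_minus c k l * u ^ k * z ^ l))) \<and>
     (\<forall>\<^sub>F (u, z) in nhds (0, 0).
        (\<lambda>(k, l). norm (full_coeff c (coeff_plus c) k l * u ^ k * z ^ l)) summable_on UNIV) \<and>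
     (\<forall>\<^sub>F (u, z) in nhds (0, 0).
        (\<lambda>(k, l). norm (full_coeff c (coeff_minus c) k l * u ^ k * z ^ l)) summable_on UNIV)"
proof -
  have plus: "profile_plus $ 0 = 1" "(1 :: complex) \<noteq> 0"
    and minus: "profile_minus $ 0 = 1" "(-1 :: complex) \<noteq> 0"
    by (simp_all add: profile_plus_def profile_minus_def)
  note plus' = solutions_of_profile[OF similarity_ode_profile_plus plus profile_plus_bound full_coeff_plus]
  note minus' = solutions_of_profile[OF similarity_ode_profile_minus minus profile_minus_bound full_coeff_minus]
  show ?thesis
    by (intro conjI allI plus' minus')
qed

end
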